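(* Let $\Omega$ be a nonempty set, $Y$ a real Banach space, $\mathcal X$ a Banach subspace of $\mathcal B(\Omega,Y)$, and let $M$ be a nonempty bounded subset of $\mathcal X$. Then $$\max\left\{\mu_\alpha(M),\ \tfrac12\,\omega_{\mathcal X}(M)\right\}\le \alpha(M)\le \mu_\alpha(M)+2\,\omega_{\mathcal X}(M).$$
   Context: $\mathcal B(\Omega,Y)$ is the Banach space of all bounded functions $f:\Omega\to Y$ with norm $\|f\|_\infty=\sup_{x\in\Omega}\|f(x)\|$. A Banach subspace of $\mathcal B(\Omega,Y)$ is a closed linear subspace equipped with $\|\cdot\|_\infty$ (possibly the whole space). For a nonempty bounded subset $M$ of a Banach space, the Kuratowski measure of noncompactness $\alpha(M)$ is the infimum of all $\varepsilon>0$ such that $M$ can be covered by finitely many sets of diameter not greater than $\varepsilon$. For $M\subseteq\mathcal X$ and $x\in\Omega$, $M(x)=\{f(x):f\in M\}\subseteq Y$, and $\mu_\alpha(M)=\sup_{x\in\Omega}\alpha(M(x))$ (with $\alpha$ taken in $Y$). For a bounded $M\subseteq \mathcal X$, $\omega_{\mathcal X}(M)$ is the infimum of all $\varepsilon>0$ for which there are a finite partition $\{A_1,\dots,A_n\}$ of $\Omega$ and a finite set $\{\varphi_1,\dots,\varphi_m\}\subseteq\mathcal X$ such that for every $f\in M$ there is $j\in\{1,\dots,m\}$ with $\operatorname{diam}((f-\varphi_j)(A_i))\le\varepsilon$ for all $i=1,\dots,n$. *)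

theory Defs
  imports "HOL-Analysis.Analysis" "HOL-Probability.Discrete_Topology"
begin

text \<open>
  The set \<open>\<Omega>\<close> is the type \<open>'w\<close> (nonempty, otherwise arbitrary). On a discrete space every function
  is continuous, so the bounded continuous functions on \<open>'w discrete\<close> are exactly the bounded
  functions on \<open>'w\<close>; see the lemmas below.
\<close>

type_synonym ('w, 'y) bfun = "'w discrete \<Rightarrow>\<^sub>C 'y"

definition bf_eval :: "('w, 'y::metric_space) bfun \<Rightarrow> 'w \<Rightarrow> 'y"
  where "bf_eval f x = apply_bcontfun f (discrete x)"

lemma range_discrete: "range discrete = UNIV"
  by (metis of_discrete_inverse surjI)

lemma range_bf_eval:
  fixes f :: "('w, 'y::metric_space) bfun"
  shows "range (bf_eval f) = range (apply_bcontfun f)"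
proof -
  have "bf_eval f = apply_bcontfun f \<circ> discrete"
    by (auto simp: bf_eval_def)
  then show ?thesis
    by (metis image_comp range_discrete)
qed

lemma bij_betw_bf_eval:
  "bij_betw bf_eval (UNIV :: ('w, 'y::metric_space) bfun set) {f. bounded (range f)}"
proof (rule bij_betw_imageI)
  show "inj (bf_eval :: ('w, 'y) bfun \<Rightarrow> _)"
  proof (rule injI)
    fix f g :: "('w, 'y) bfun"
    assume "bf_eval f = bf_eval g"
    then have "apply_bcontfun f (discrete x) = apply_bcontfun g (discrete x)" for x
      by (metis bf_eval_def)
    then show "f = g"
      by (metis bcontfun_eqI of_discrete_inverse)
  qed
  show "range (bf_eval :: ('w, 'y) bfun \<Rightarrow> _) = {f. bounded (range f)}"
  proof (intro equalityI subsetI)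
    fix h :: "'w \<Rightarrow> 'y"
    assume "h \<in> range bf_eval"
    then obtain f :: "('w, 'y) bfun" where "h = bf_eval f"
      by blast
    then show "h \<in> {f. bounded (range f)}"
      by (simp add: range_bf_eval)
  next
    fix h :: "'w \<Rightarrow> 'y"
    assume h: "h \<in> {f. bounded (range f)}"
    have "range (\<lambda>z. h (of_discrete z)) \<subseteq> range h"
      by auto
    with h have "bounded (range (\<lambda>z. h (of_discrete z)))"
      using bounded_subset by blast
    moreover have "continuous_on UNIV (\<lambda>z. h (of_discrete z))"
      by (simp add: continuous_on_open_vimage open_discrete)
    ultimately have "(\<lambda>z. h (of_discrete z)) \<in> bcontfun"
      by (simp add: bcontfun_def)
    then have "bf_eval (Bcontfun (\<lambda>z. h (of_discrete z))) = h"
      by (auto simp: bf_eval_def Bcontfun_inverse discrete_inverse)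
    then show "h \<in> range bf_eval"
      by (metis rangeI)
  qed
qed

lemma bf_eval_linear:
  fixes f g :: "('w, 'y::real_normed_vector) bfun"
  shows "bf_eval (f + g) x = bf_eval f x + bf_eval g x"
    and "bf_eval (f - g) x = bf_eval f x - bf_eval g x"
    and "bf_eval (c *\<^sub>R f) x = c *\<^sub>R bf_eval f x"
    and "bf_eval (0 :: ('w, 'y) bfun) x = 0"
  by (simp_all add: bf_eval_def)

lemma norm_bfun_eq_SUP:
  fixes f :: "('w, 'y::real_normed_vector) bfun"
  shows "norm f = (SUP x. norm (bf_eval f x))"
proof -
  have "range (\<lambda>x. norm (bf_eval f x)) = norm ` range (bf_eval f)"
    by auto
  also have "\<dots> = range (\<lambda>z. norm (apply_bcontfun f z))"
    by (auto simp: range_bf_eval)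
  finally show ?thesis
    by (simp add: norm_bcontfun_def dist_bcontfun_def)
qed

text \<open>The requirement \<open>bounded C\<close> is needed because \<open>diameter\<close> is an unspecified real number on
  unbounded sets.\<close>

definition kuratowski :: "'a::metric_space set \<Rightarrow> real"
  where "kuratowski M =
    Inf {\<epsilon>. \<epsilon> > 0 \<and> (\<exists>\<C>. finite \<C> \<and> M \<subseteq> \<Union>\<C> \<and> (\<forall>C\<in>\<C>. bounded C \<and> diameter C \<le> \<epsilon>))}"

definition mu_kuratowski :: "('w, 'y::metric_space) bfun set \<Rightarrow> real"
  where "mu_kuratowski M = (SUP x. kuratowski ((\<lambda>f. bf_eval f x) ` M))"

definition omega :: "('w, 'y::real_normed_vector) bfun set \<Rightarrow> ('w, 'y) bfun set \<Rightarrow> real"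
  where "omega X M =
    Inf {\<epsilon>. \<epsilon> > 0 \<and> (\<exists>P \<Phi>. finite P \<and> partition_on (UNIV :: 'w set) P \<and> finite \<Phi> \<and> \<Phi> \<subseteq> X \<and>
      (\<forall>f\<in>M. \<exists>\<phi>\<in>\<Phi>. \<forall>A\<in>P. diameter (bf_eval (f - \<phi>) ` A) \<le> \<epsilon>))}"

end

theory Submission
  imports Defs
begin

text \<open>
  Evaluation at a point is 1-Lipschitz, so covers of \<open>M\<close> induce covers of every \<open>M(x)\<close>. Picking a
  member of \<open>M\<close> in each set of a cover of \<open>M\<close> gives the functions \<open>\<phi>\<^sub>j\<close> for the trivial partition
  \<open>{\<Omega>}\<close>; passing from distances to oscillations costs the factor 2. For the upper bound, sort \<open>M\<close>
  by the index \<open>j\<close> and by the sets that the values at one chosen point of each part of the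
  partition fall into. Two functions in the same class differ by at most
  \<open>\<epsilon> + \<delta> + \<epsilon>\<close> at every point.
\<close>

section \<open>Passing between the two infima and their witnesses\<close>

lemma kuratowski_le:
  assumes "\<epsilon> > 0" "finite \<C>" "M \<subseteq> \<Union>\<C>" "\<And>C. C \<in> \<C> \<Longrightarrow> bounded C \<and> diameter C \<le> \<epsilon>"
  shows "kuratowski M \<le> \<epsilon>"
  unfolding kuratowski_def
proof (rule cInf_lower)
  show "bdd_below {\<epsilon>. \<epsilon> > 0 \<and> (\<exists>\<C>. finite \<C> \<and> M \<subseteq> \<Union>\<C> \<and> (\<forall>C\<in>\<C>. bounded C \<and> diameter C \<le> \<epsilon>))}"
    by (rule bdd_belowI[of _ 0]) auto
qed (use assms in blast)

text \<open>The infimum need not be attained, but a strict upper bound always leaves room for a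
  witness. Boundedness of \<open>M\<close> makes the set of admissible values nonempty, because
  \<open>M\<close> covers itself; the infimum of an empty set of reals would carry no
  information.\<close>

lemma kuratowski_lessE:
  assumes "bounded M" "kuratowski M < d"
  obtains \<epsilon> \<C> where "0 < \<epsilon>" "\<epsilon> < d" "finite \<C>" "M \<subseteq> \<Union>\<C>"
    "\<And>C. C \<in> \<C> \<Longrightarrow> bounded C \<and> diameter C \<le> \<epsilon>"
proof -
  let ?E = "{\<epsilon>. \<epsilon> > 0 \<and> (\<exists>\<C>. finite \<C> \<and> M \<subseteq> \<Union>\<C> \<and> (\<forall>C\<in>\<C>. bounded C \<and> diameter C \<le> \<epsilon>))}"
  \<comment> \<open>The summand 1 keeps the bound positive when \<open>M\<close> has diameter
    0.\<close>
  have "finite {M} \<and> M \<subseteq> \<Union>{M} \<and> (\<forall>C\<in>{M}. bounded C \<and> diameter C \<le> diameter M + 1)"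
    using assms(1) by simp
  moreover have "diameter M + 1 > 0"
    using diameter_ge_0[OF assms(1)] by simp
  ultimately have "diameter M + 1 \<in> ?E"
    by blast
  then have "?E \<noteq> {}"
    by blast
  moreover have "Inf ?E < d"
    using assms(2) by (simp only: kuratowski_def)
  ultimately have "\<exists>\<epsilon>\<in>?E. \<epsilon> < d"
    by (rule cInf_lessD)
  then show ?thesis
    using that by blast
qed

lemma omega_le:
  fixes X M :: "('w, 'y::real_normed_vector) bfun set"
  assumes "\<epsilon> > 0" "finite P" "partition_on UNIV P" "finite \<Phi>" "\<Phi> \<subseteq> X"
    "\<And>f. f \<in> M \<Longrightarrow> \<exists>\<phi>\<in>\<Phi>. \<forall>A\<in>P. diameter (bf_eval (f - \<phi>) ` A) \<le> \<epsilon>"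
  shows "omega X M \<le> \<epsilon>"
  unfolding omega_def
proof (rule cInf_lower)
  show "bdd_below {\<epsilon>. \<epsilon> > 0 \<and> (\<exists>P \<Phi>. finite P \<and> partition_on (UNIV :: 'w set) P \<and> finite \<Phi> \<and> \<Phi> \<subseteq> X \<and>
      (\<forall>f\<in>M. \<exists>\<phi>\<in>\<Phi>. \<forall>A\<in>P. diameter (bf_eval (f - \<phi>) ` A) \<le> \<epsilon>))}"
    by (rule bdd_belowI[of _ 0]) auto
qed (use assms in blast)

section \<open>Evaluation maps and diameters\<close>

lemma dist_bf_eval_le: "dist (bf_eval f x) (bf_eval g x) \<le> dist f g"
  unfolding bf_eval_def by (rule dist_bounded)

lemma bounded_bf_eval_image: "bounded (bf_eval f ` A)"
proof -
  have "bounded (range (bf_eval f))"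
    by (simp add: range_bf_eval)
  then show ?thesis
    by (rule bounded_subset) auto
qed

lemma bounded_eval_image:
  assumes "bounded M"
  shows "bounded ((\<lambda>f. bf_eval f x) ` M)"
proof -
  obtain g e where "\<forall>f\<in>M. dist g f \<le> e"
    using assms unfolding bounded_def by blast
  then have "\<forall>y\<in>(\<lambda>f. bf_eval f x) ` M. dist (bf_eval g x) y \<le> e"
    using dist_bf_eval_le order_trans by fast
  then show ?thesis
    unfolding bounded_def by blast
qed

lemma diameter_le_dist:
  fixes S :: "'a::metric_space set"
  assumes "d \<ge> 0" "\<And>x y. x \<in> S \<Longrightarrow> y \<in> S \<Longrightarrow> dist x y \<le> d"
  shows "diameter S \<le> d"
proof (cases "S = {}")
  case False
  then show ?thesis
    unfolding diameter_def using assms by (auto intro!: cSUP_least)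
qed (use assms in simp)

section \<open>The two lower bounds for \<open>kuratowski M\<close>\<close>

lemma kuratowski_eval_le:
  assumes "bounded M"
  shows "kuratowski ((\<lambda>f. bf_eval f x) ` M) \<le> kuratowski M"
proof (rule field_le_epsilon)
  fix e :: real assume "e > 0"
  then obtain \<epsilon> \<C> where \<epsilon>: "0 < \<epsilon>" "\<epsilon> < kuratowski M + e" and \<C>: "finite \<C>" "M \<subseteq> \<Union>\<C>"
    "\<And>C. C \<in> \<C> \<Longrightarrow> bounded C \<and> diameter C \<le> \<epsilon>"
    using kuratowski_lessE[OF assms, of "kuratowski M + e"] by auto
  have "kuratowski ((\<lambda>f. bf_eval f x) ` M) \<le> \<epsilon>"
  proof (rule kuratowski_le[OF \<open>0 < \<epsilon>\<close>])
    show "finite ((`) (\<lambda>f. bf_eval f x) ` \<C>)"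
      using \<C>(1) by simp
    show "(\<lambda>f. bf_eval f x) ` M \<subseteq> \<Union>((`) (\<lambda>f. bf_eval f x) ` \<C>)"
      using \<C>(2) by blast
    fix D assume "D \<in> (`) (\<lambda>f. bf_eval f x) ` \<C>"
    then obtain C where C: "C \<in> \<C>" "D = (\<lambda>f. bf_eval f x) ` C"
      by blast
    have "dist (bf_eval f x) (bf_eval g x) \<le> \<epsilon>" if "f \<in> C" "g \<in> C" for f g
      using dist_bf_eval_le[of f x g] diameter_bounded_bound[of C f g] \<C>(3)[OF C(1)] that
      by linarith
    then have "diameter D \<le> \<epsilon>"
      using \<epsilon> C by (intro diameter_le_dist) auto
    then show "bounded D \<and> diameter D \<le> \<epsilon>"
      using \<C>(3)[OF C(1)] by (simp add: C(2) bounded_eval_image)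
  qed
  with \<epsilon> show "kuratowski ((\<lambda>f. bf_eval f x) ` M) \<le> kuratowski M + e"
    by simp
qed

lemma mu_kuratowski_le:
  assumes "bounded M"
  shows "mu_kuratowski M \<le> kuratowski M"
  unfolding mu_kuratowski_def
  by (rule cSUP_least[OF UNIV_not_empty kuratowski_eval_le[OF assms]])

text \<open>A real supremum dominates its terms only if the family is bounded above; here
  \<open>kuratowski M\<close> is such a bound, uniform in \<open>x\<close>.\<close>

lemma kuratowski_eval_le_mu:
  assumes "bounded M"
  shows "kuratowski ((\<lambda>f. bf_eval f x) ` M) \<le> mu_kuratowski M"
  unfolding mu_kuratowski_def
  by (rule cSUP_upper[OF UNIV_I bdd_aboveI2[OF kuratowski_eval_le[OF assms]]])

text \<open>If \<open>f\<close> and a chosen member of \<open>M\<close> share a set of the cover,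
  their difference takes values in the closed ball of radius \<open>\<epsilon>\<close> about 0,
  which has diameter at most \<open>2 * \<epsilon>\<close>. Besides the lower bound, this shows that
  the infimum defining \<open>omega X M\<close> is over a nonempty set.\<close>

lemma omega_witness_of_cover:
  fixes X M :: "('w, 'y::real_normed_vector) bfun set"
  assumes "M \<subseteq> X" "\<epsilon> > 0" "finite \<C>" "M \<subseteq> \<Union>\<C>"
    "\<And>C. C \<in> \<C> \<Longrightarrow> bounded C \<and> diameter C \<le> \<epsilon>"
  obtains \<Phi> where "finite \<Phi>" "\<Phi> \<subseteq> X"
    "\<And>f. f \<in> M \<Longrightarrow> \<exists>\<phi>\<in>\<Phi>. diameter (range (bf_eval (f - \<phi>))) \<le> 2 * \<epsilon>"
proof -
  define p where "p C = (SOME f. f \<in> C \<inter> M)" for C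
  have p: "p C \<in> C \<inter> M" if "f \<in> C" "f \<in> M" for f C
  proof -
    have "C \<inter> M \<noteq> {}"
      using that by blast
    then show ?thesis
      unfolding p_def some_in_eq by simp
  qed
  \<comment> \<open>Sets that miss \<open>M\<close> are dropped: for them \<open>p C\<close> is
    arbitrary and might lie outside \<open>X\<close>.\<close>
  define \<Phi> where "\<Phi> = p ` {C \<in> \<C>. C \<inter> M \<noteq> {}}"
  have "\<exists>\<phi>\<in>\<Phi>. diameter (range (bf_eval (f - \<phi>))) \<le> 2 * \<epsilon>" if f: "f \<in> M" for f
  proof -
    obtain C where C: "C \<in> \<C>" "f \<in> C"
      using assms(4) f by blast
    have "dist f (p C) \<le> \<epsilon>"
      using diameter_bounded_bound[of C f "p C"] assms(5)[OF C(1)] C p[OF C(2) f] by auto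
    then have *: "norm (bf_eval f x - bf_eval (p C) x) \<le> \<epsilon>" for x
      using dist_bf_eval_le[of f x "p C"] by (simp add: dist_norm)
    have "dist (bf_eval (f - p C) x) (bf_eval (f - p C) y) \<le> 2 * \<epsilon>" for x y
      using norm_triangle_ineq4[of "bf_eval (f - p C) x" "bf_eval (f - p C) y"] *[of x] *[of y]
      by (simp add: dist_norm bf_eval_linear)
    then have "diameter (range (bf_eval (f - p C))) \<le> 2 * \<epsilon>"
      using assms(2) by (intro diameter_le_dist) auto
    moreover have "p C \<in> \<Phi>"
      using C f by (auto simp: \<Phi>_def)
    ultimately show ?thesis
      by blast
  qed
  moreover have "finite \<Phi>" "\<Phi> \<subseteq> X"
    unfolding \<Phi>_def using assms(1,3) p by (simp, blast)
  ultimately show ?thesis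
    using that by blast
qed

lemma partition_on_singleton_UNIV: "partition_on UNIV {UNIV :: 'a set}"
  by (simp add: partition_on_def)

lemma omega_le_kuratowski:
  fixes X M :: "('w, 'y::real_normed_vector) bfun set"
  assumes "M \<subseteq> X" "bounded M"
  shows "omega X M \<le> 2 * kuratowski M"
proof (rule field_le_epsilon)
  fix e :: real assume "e > 0"
  \<comment> \<open>The slack is \<open>e / 2\<close> because \<open>\<epsilon>\<close> gets
    doubled.\<close>
  then obtain \<epsilon> \<C> where \<epsilon>: "0 < \<epsilon>" "\<epsilon> < kuratowski M + e / 2" and \<C>: "finite \<C>" "M \<subseteq> \<Union>\<C>"
    "\<And>C. C \<in> \<C> \<Longrightarrow> bounded C \<and> diameter C \<le> \<epsilon>"
    using kuratowski_lessE[OF assms(2), of "kuratowski M + e / 2"] by auto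
  obtain \<Phi> where "finite \<Phi>" "\<Phi> \<subseteq> X"
    "\<And>f. f \<in> M \<Longrightarrow> \<exists>\<phi>\<in>\<Phi>. diameter (range (bf_eval (f - \<phi>))) \<le> 2 * \<epsilon>"
    using omega_witness_of_cover[OF assms(1) \<epsilon>(1) \<C>] by blast
  then have "omega X M \<le> 2 * \<epsilon>"
    using \<epsilon> by (intro omega_le[OF _ _ partition_on_singleton_UNIV]) auto
  with \<epsilon> show "omega X M \<le> 2 * kuratowski M + e"
    by simp
qed

section \<open>The upper bound for \<open>kuratowski M\<close>\<close>

lemma omega_lessE:
  fixes X M :: "('w, 'y::real_normed_vector) bfun set"
  assumes "M \<subseteq> X" "bounded M" "omega X M < d"
  obtains \<epsilon> P \<Phi> where "0 < \<epsilon>" "\<epsilon> < d" "finite P" "partition_on (UNIV :: 'w set) P" "finite \<Phi>"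
    "\<And>f. f \<in> M \<Longrightarrow> \<exists>\<phi>\<in>\<Phi>. \<forall>A\<in>P. diameter (bf_eval (f - \<phi>) ` A) \<le> \<epsilon>"
proof -
  let ?E = "{\<epsilon>. \<epsilon> > 0 \<and> (\<exists>P \<Phi>. finite P \<and> partition_on (UNIV :: 'w set) P \<and> finite \<Phi> \<and> \<Phi> \<subseteq> X \<and>
      (\<forall>f\<in>M. \<exists>\<phi>\<in>\<Phi>. \<forall>A\<in>P. diameter (bf_eval (f - \<phi>) ` A) \<le> \<epsilon>))}"
  \<comment> \<open>Any finite cover by bounded sets will do here: it yields one admissible value,
    so the infimum is a genuine one.\<close>
  obtain \<epsilon> \<C> where "0 < \<epsilon>" and \<C>: "finite \<C>" "M \<subseteq> \<Union>\<C>"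
    "\<And>C. C \<in> \<C> \<Longrightarrow> bounded C \<and> diameter C \<le> \<epsilon>"
    using kuratowski_lessE[OF assms(2) less_add_one] by metis
  obtain \<Phi> where \<Phi>: "finite \<Phi>" "\<Phi> \<subseteq> X"
    "\<And>f. f \<in> M \<Longrightarrow> \<exists>\<phi>\<in>\<Phi>. diameter (range (bf_eval (f - \<phi>))) \<le> 2 * \<epsilon>"
    using omega_witness_of_cover[OF assms(1) \<open>0 < \<epsilon>\<close> \<C>] by blast
  have "finite {UNIV} \<and> partition_on (UNIV :: 'w set) {UNIV} \<and> finite \<Phi> \<and> \<Phi> \<subseteq> X \<and>
      (\<forall>f\<in>M. \<exists>\<phi>\<in>\<Phi>. \<forall>A\<in>{UNIV}. diameter (bf_eval (f - \<phi>) ` A) \<le> 2 * \<epsilon>)"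
    using \<Phi> by (simp add: partition_on_singleton_UNIV)
  moreover have "2 * \<epsilon> > 0"
    using \<open>0 < \<epsilon>\<close> by simp
  ultimately have "2 * \<epsilon> \<in> ?E"
    by blast
  then have "?E \<noteq> {}"
    by blast
  moreover have "Inf ?E < d"
    using assms(3) by (simp only: omega_def)
  ultimately have "\<exists>\<epsilon>\<in>?E. \<epsilon> < d"
    by (rule cInf_lessD)
  then show ?thesis
    using that by blast
qed

lemma kuratowski_le_partition:
  fixes M :: "('w, 'y::real_normed_vector) bfun set"
  assumes "\<epsilon> > 0" "\<delta> > 0" "bounded M"
    and P: "finite P" "partition_on (UNIV :: 'w set) P"
    and \<Phi>: "finite \<Phi>" "\<And>f. f \<in> M \<Longrightarrow> \<exists>\<phi>\<in>\<Phi>. \<forall>A\<in>P. diameter (bf_eval (f - \<phi>) ` A) \<le> \<epsilon>"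
    and \<delta>: "\<And>x. kuratowski ((\<lambda>f. bf_eval f x) ` M) < \<delta>"
  shows "kuratowski M \<le> \<delta> + 2 * \<epsilon>"
proof -
  have "\<exists>\<C>. finite \<C> \<and> (\<lambda>f. bf_eval f x) ` M \<subseteq> \<Union>\<C> \<and> (\<forall>C\<in>\<C>. bounded C \<and> diameter C \<le> \<delta>)" for x
  proof -
    obtain \<eta> \<C> where "\<eta> < \<delta>" "finite \<C>" "(\<lambda>f. bf_eval f x) ` M \<subseteq> \<Union>\<C>"
      "\<And>C. C \<in> \<C> \<Longrightarrow> bounded C \<and> diameter C \<le> \<eta>"
      using kuratowski_lessE[OF bounded_eval_image[OF assms(3)] \<delta>] by metis
    then show ?thesis
      \<comment> \<open>The witness \<open>\<eta>\<close> varies with \<open>x\<close>; weakening it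
        to \<open>\<delta>\<close> gives one diameter bound for all points.\<close>
      by (meson less_imp_le order_trans)
  qed
  then obtain \<C> where \<C>: "\<And>x. finite (\<C> x)" "\<And>x. (\<lambda>f. bf_eval f x) ` M \<subseteq> \<Union>(\<C> x)"
    "\<And>x C. C \<in> \<C> x \<Longrightarrow> bounded C \<and> diameter C \<le> \<delta>"
    by metis
  have "\<exists>C. C \<in> \<C> x \<and> bf_eval f x \<in> C" if "f \<in> M" for f x
    using \<C>(2)[of x] that by blast
  then obtain c where c: "\<And>f x. f \<in> M \<Longrightarrow> c f x \<in> \<C> x \<and> bf_eval f x \<in> c f x"
    by metis
  obtain j where j: "\<And>f. f \<in> M \<Longrightarrow> j f \<in> \<Phi> \<and> (\<forall>A\<in>P. diameter (bf_eval (f - j f) ` A) \<le> \<epsilon>)"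
    using \<Phi>(2) by metis
  \<comment> \<open>One sample point per part: only finitely many of the covers
    \<open>\<C> x\<close> enter the classification.\<close>
  define pt where "pt A = (SOME x. x \<in> A)" for A :: "'w set"
  have pt: "pt A \<in> A" if "A \<in> P" for A
  proof -
    have "A \<noteq> {}"
      using that P(2) by (auto simp: partition_on_def)
    then show ?thesis
      by (simp add: pt_def some_in_eq)
  qed
  \<comment> \<open>Functions with equal \<open>key\<close> form one class. Restricting to
    \<open>P\<close> places the second component in a finite product of finite sets, so there are
    finitely many classes.\<close>
  define key where "key f = (j f, restrict (\<lambda>A. c f (pt A)) P)" for f
  have "key ` M \<subseteq> \<Phi> \<times> (\<Pi>\<^sub>E A\<in>P. \<C> (pt A))"
    using j c by (auto simp: key_def)
  moreover have "finite (\<Phi> \<times> (\<Pi>\<^sub>E A\<in>P. \<C> (pt A)))"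
    using \<Phi>(1) P(1) \<C>(1) by (intro finite_cartesian_product finite_PiE) auto
  ultimately have fin: "finite (key ` M)"
    by (rule finite_subset)
  show ?thesis
  proof (rule kuratowski_le)
    show "finite ((\<lambda>k. {f \<in> M. key f = k}) ` key ` M)"
      using fin by simp
    show "M \<subseteq> \<Union>((\<lambda>k. {f \<in> M. key f = k}) ` key ` M)"
      by blast
    fix C assume "C \<in> (\<lambda>k. {f \<in> M. key f = k}) ` key ` M"
    then obtain k where C: "C = {f \<in> M. key f = k}"
      by blast
    \<comment> \<open>The distance is a supremum, so a bound at each point \<open>z\<close>
      suffices.\<close>
    have "dist f g \<le> \<delta> + 2 * \<epsilon>" if "f \<in> C" "g \<in> C" for f g
    proof (rule dist_bound)
      fix z :: "'w discrete"
      have fg: "f \<in> M" "g \<in> M" "key f = key g"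
        using that C by auto
      define x where "x = of_discrete z"
      obtain A where A: "A \<in> P" "x \<in> A"
        using partition_onD1[OF P(2)] by blast
      define \<phi> where "\<phi> = j f"
      have "j g = \<phi>" and cc: "c f (pt A) = c g (pt A)"
        using fg A unfolding key_def \<phi>_def by (auto dest: fun_cong[of _ _ A])
      have osc: "dist (bf_eval (h - \<phi>) x) (bf_eval (h - \<phi>) (pt A)) \<le> \<epsilon>" if "h \<in> {f, g}" for h
      proof -
        have "diameter (bf_eval (h - \<phi>) ` A) \<le> \<epsilon>"
          using that j[OF fg(1)] j[OF fg(2)] A \<open>j g = \<phi>\<close> \<phi>_def by auto
        moreover have "dist (bf_eval (h - \<phi>) x) (bf_eval (h - \<phi>) (pt A)) \<le> diameter (bf_eval (h - \<phi>) ` A)"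
          using A pt by (intro diameter_bounded_bound bounded_bf_eval_image) auto
        ultimately show ?thesis
          by simp
      qed
      have "dist (bf_eval f (pt A)) (bf_eval g (pt A)) \<le> diameter (c f (pt A))"
        using c[of f "pt A"] c[of g "pt A"] fg cc \<C>(3) by (intro diameter_bounded_bound) auto
      also have "\<dots> \<le> \<delta>"
        using c fg \<C>(3) by blast
      finally have mid: "norm (bf_eval f (pt A) - bf_eval g (pt A)) \<le> \<delta>"
        by (simp add: dist_norm)
      \<comment> \<open>In \<open>?u - ?v + ?w\<close> the values of \<open>\<phi>\<close> cancel,
        as do those of \<open>f\<close> and \<open>g\<close> at \<open>pt A\<close>, leaving the
        difference at \<open>x\<close>. The oscillations \<open>?u\<close> and \<open>?v\<close>
        cost \<open>\<epsilon>\<close> each, the sample difference \<open>?w\<close> costs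
        \<open>\<delta>\<close>.\<close>
      let ?u = "bf_eval (f - \<phi>) x - bf_eval (f - \<phi>) (pt A)"
      let ?v = "bf_eval (g - \<phi>) x - bf_eval (g - \<phi>) (pt A)"
      let ?w = "bf_eval f (pt A) - bf_eval g (pt A)"
      have "norm (bf_eval f x - bf_eval g x) = norm (?u - ?v + ?w)"
        by (simp add: bf_eval_linear)
      also have "norm (?u - ?v + ?w) \<le> norm (?u - ?v) + norm ?w"
        by (rule norm_triangle_ineq)
      also have "norm (?u - ?v) \<le> norm ?u + norm ?v"
        by (rule norm_triangle_ineq4)
      also have "norm ?u + norm ?v + norm ?w \<le> \<delta> + 2 * \<epsilon>"
        using osc[of f] osc[of g] mid by (simp add: dist_norm)
      finally show "dist (apply_bcontfun f z) (apply_bcontfun g z) \<le> \<delta> + 2 * \<epsilon>"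
        by (simp add: dist_norm bf_eval_def x_def of_discrete_inverse)
    qed
    then have "diameter C \<le> \<delta> + 2 * \<epsilon>"
      using assms(1,2) by (intro diameter_le_dist) auto
    moreover have "bounded C"
      using assms(3) by (rule bounded_subset) (auto simp: C)
    ultimately show "bounded C \<and> diameter C \<le> \<delta> + 2 * \<epsilon>"
      by blast
  qed (use assms in simp)
qed

text \<open>A negative infimum would produce an admissible value that is both positive and below
  0.\<close>

lemma kuratowski_nonneg:
  assumes "bounded M"
  shows "kuratowski M \<ge> 0"
proof (rule ccontr)
  assume "\<not> kuratowski M \<ge> 0"
  then show False
    using kuratowski_lessE[OF assms, of 0] by force
qed

lemma kuratowski_le_mu_omega:
  fixes X M :: "('w, 'y::real_normed_vector) bfun set"
  assumes "M \<subseteq> X" "bounded M"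
  shows "kuratowski M \<le> mu_kuratowski M + 2 * omega X M"
proof (rule field_le_epsilon)
  fix e :: real assume "e > 0"
  \<comment> \<open>The slack \<open>e / 4\<close> is doubled to \<open>e / 2\<close>; the other
    \<open>e / 2\<close> makes the pointwise bound by \<open>mu_kuratowski M\<close> strict.\<close>
  then obtain \<epsilon> P \<Phi> where \<epsilon>: "0 < \<epsilon>" "\<epsilon> < omega X M + e / 4"
    and P: "finite P" "partition_on (UNIV :: 'w set) P"
    and \<Phi>: "finite \<Phi>" "\<And>f. f \<in> M \<Longrightarrow> \<exists>\<phi>\<in>\<Phi>. \<forall>A\<in>P. diameter (bf_eval (f - \<phi>) ` A) \<le> \<epsilon>"
    using omega_lessE[OF assms, of "omega X M + e / 4"] by auto
  have less: "kuratowski ((\<lambda>f. bf_eval f x) ` M) < mu_kuratowski M + e / 2" for x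
    using kuratowski_eval_le_mu[OF assms(2), of x] \<open>e > 0\<close> by linarith
  have "mu_kuratowski M + e / 2 > 0"
    using kuratowski_nonneg[OF bounded_eval_image[OF assms(2)]] less by (meson le_less_trans)
  then have "kuratowski M \<le> mu_kuratowski M + e / 2 + 2 * \<epsilon>"
    using kuratowski_le_partition[OF \<epsilon>(1) _ assms(2) P \<Phi> less] by blast
  with \<epsilon> show "kuratowski M \<le> mu_kuratowski M + 2 * omega X M + e"
    by linarith
qed

theorem theorem3p1:
  fixes X M :: "('w, 'y::banach) bfun set"
  assumes "subspace X" and "closed X"
    and "M \<subseteq> X" and "M \<noteq> {}" and "bounded M"
  shows "max (mu_kuratowski M) (1 / 2 * omega X M) \<le> kuratowski M
    \<and> kuratowski M \<le> mu_kuratowski M + 2 * omega X M"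
  using mu_kuratowski_le[OF assms(5)] omega_le_kuratowski[OF assms(3,5)]
    kuratowski_le_mu_omega[OF assms(3,5)]
  by simp

end
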